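(* Let $M=(S,T,I,L,F=\{F_0,\ldots,F_f\})$ be a fair Kripke structure and let $M_{L2S}$ be its liveness-to-safety transformation. Then $M$ has an initialised fair path if and only if some state $\tilde{s}$ with $\mathit{LoopClosed}(\tilde{s})$ true is reachable in $M_{L2S}$.
   Context: A fair Kripke structure $M=(S,T,I,L,F)$ has finite state set $S$, total transition relation $T\subseteq S\times S$, initial states $I\subseteq S$, labelling $L:S\to2^{AP}$, and acceptance sets $F_0,\dots,F_f\subseteq S$; an infinite path $s_0s_1\ldots$ is initialised if $s_0\in I$ and fair if it visits each $F_m$ infinitely often. Regard the states of $M$ as values of a single state variable $v$ with range $S$. The transformed Kripke structure $M_{L2S}=(S_{L2S},T_{L2S},I_{L2S},L_{L2S})$ has state variables $v$ and $\hat v$ (range $S$) and Booleans $l_s$, $\mathit{InLoop}$, $\mathit{LoopClosed}$, $Acc_m$ ($0\le m\le f$); primed variables denote next-state values. $S_{L2S}$, $I_{L2S}$, $T_{L2S}$ are the largest sets of states / state pairs satisfying: (states) $v\in S$; $\mathit{LoopClosed}\Rightarrow\mathit{InLoop}$; $\mathit{LoopClosed}\Rightarrow v=\hat v$; $\mathit{LoopClosed}\Rightarrow Acc_m$ for all $m$. (initial) the state constraints, $v\in I$, $l_s\Leftrightarrow\bot$, $\mathit{InLoop}\Leftrightarrow\bot$, $Acc_m\Leftrightarrow\bot$ for all $m$. (transitions) both states in $S_{L2S}$, $(v,v')\in T$; $\mathit{InLoop}'\Leftrightarrow\mathit{InLoop}\vee l_s'$; $\mathit{InLoop}\Rightarrow\neg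 l_s'$; $(l_s'\Rightarrow\hat v'=v)\wedge(\neg l_s'\Rightarrow\hat v'=\hat v)$; $Acc_m'\Leftrightarrow Acc_m\vee(\mathit{InLoop}'\wedge v'\in F_m)$ for all $m$. $L_{L2S}(\tilde s)=L(v(\tilde s))$, plus the proposition $\mathit{LoopClosed}$ when it is true. A state is reachable if it is the last state of a finite path of $M_{L2S}$ starting in $I_{L2S}$. *)

theory Defs
  imports Main "HOL-Library.Infinite_Set"
begin

record ('s, 'ap) kripke =
  states :: "'s set"
  trans_rel :: "('s \<times> 's) set"
  inits :: "'s set"
  label :: "'s \<Rightarrow> 'ap set"

text \<open>The acceptance sets are \<open>accept M 0, \<dots>, accept M (last_acc M)\<close>, that is, \<open>F\<^sub>0, \<dots>, F\<^sub>f\<close> with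
  \<open>f = last_acc M\<close>; values of \<open>accept M\<close> beyond \<open>last_acc M\<close> are never used. The set of atomic
  propositions is the type \<open>'ap\<close>.\<close>

record ('s, 'ap) fair_kripke = "('s, 'ap) kripke" +
  last_acc :: nat
  accept :: "nat \<Rightarrow> 's set"

definition is_fair_kripke :: "('s, 'ap) fair_kripke \<Rightarrow> bool" where
  "is_fair_kripke M \<longleftrightarrow>
     finite (states M) \<and>
     trans_rel M \<subseteq> states M \<times> states M \<and>
     (\<forall>s\<in>states M. \<exists>t\<in>states M. (s, t) \<in> trans_rel M) \<and>
     inits M \<subseteq> states M \<and>
     (\<forall>m\<le>last_acc M. accept M m \<subseteq> states M)"

definition infinite_path :: "('s, 'ap, 'z) kripke_scheme \<Rightarrow> (nat \<Rightarrow> 's) \<Rightarrow> bool" where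
  "infinite_path M p \<longleftrightarrow>
     (\<forall>i. p i \<in> states M) \<and> (\<forall>i. (p i, p (Suc i)) \<in> trans_rel M)"

definition initialised :: "('s, 'ap, 'z) kripke_scheme \<Rightarrow> (nat \<Rightarrow> 's) \<Rightarrow> bool" where
  "initialised M p \<longleftrightarrow> p 0 \<in> inits M"

definition fair :: "('s, 'ap) fair_kripke \<Rightarrow> (nat \<Rightarrow> 's) \<Rightarrow> bool" where
  "fair M p \<longleftrightarrow> (\<forall>m\<le>last_acc M. \<exists>\<^sub>\<infinity>i. p i \<in> accept M m)"

definition finite_path :: "('s, 'ap, 'z) kripke_scheme \<Rightarrow> 's list \<Rightarrow> bool" where
  "finite_path M xs \<longleftrightarrow>
     xs \<noteq> [] \<and> set xs \<subseteq> states M \<and>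
     (\<forall>i. Suc i < length xs \<longrightarrow> (xs ! i, xs ! Suc i) \<in> trans_rel M)"

definition reachable :: "('s, 'ap, 'z) kripke_scheme \<Rightarrow> 's \<Rightarrow> bool" where
  "reachable M s \<longleftrightarrow> (\<exists>xs. finite_path M xs \<and> hd xs \<in> inits M \<and> last xs = s)"

record 's l2s_state =
  v_cur :: 's
  v_hat :: 's
  l_s :: bool
  InLoop :: bool
  LoopClosed :: bool
  Acc :: "nat \<Rightarrow> bool"

datatype 'ap l2s_prop = Orig 'ap | LoopClosedProp

text \<open>A valuation has Booleans \<open>Acc m\<close> only for \<open>m \<le> last_acc M\<close>. As \<open>Acc\<close> is a total function here,
  its remaining values are fixed to \<open>False\<close>, so that each valuation of the intended variables is
  represented exactly once (and the state set stays finite).\<close>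

definition l2s_valuations :: "('s, 'ap) fair_kripke \<Rightarrow> 's l2s_state set" where
  "l2s_valuations M =
     {x. v_cur x \<in> states M \<and> v_hat x \<in> states M \<and> (\<forall>m>last_acc M. \<not> Acc x m)}"

text \<open>The largest set of valuations (of pairs of valuations) satisfying given constraints is the
  corresponding set comprehension.\<close>

definition l2s_states :: "('s, 'ap) fair_kripke \<Rightarrow> 's l2s_state set" where
  "l2s_states M =
     {x \<in> l2s_valuations M.
        v_cur x \<in> states M \<and>
        (LoopClosed x \<longrightarrow> InLoop x) \<and>
        (LoopClosed x \<longrightarrow> v_cur x = v_hat x) \<and>
        (\<forall>m\<le>last_acc M. LoopClosed x \<longrightarrow> Acc x m)}"

definition l2s_inits :: "('s, 'ap) fair_kripke \<Rightarrow> 's l2s_state set" where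
  "l2s_inits M =
     {x \<in> l2s_states M.
        v_cur x \<in> inits M \<and>
        (l_s x \<longleftrightarrow> False) \<and>
        (InLoop x \<longleftrightarrow> False) \<and>
        (\<forall>m\<le>last_acc M. Acc x m \<longleftrightarrow> False)}"

definition l2s_trans :: "('s, 'ap) fair_kripke \<Rightarrow> ('s l2s_state \<times> 's l2s_state) set" where
  "l2s_trans M =
     {(x, x'). x \<in> l2s_states M \<and> x' \<in> l2s_states M \<and>
        (v_cur x, v_cur x') \<in> trans_rel M \<and>
        (InLoop x' \<longleftrightarrow> InLoop x \<or> l_s x') \<and>
        (InLoop x \<longrightarrow> \<not> l_s x') \<and>
        (l_s x' \<longrightarrow> v_hat x' = v_cur x) \<and>
        (\<not> l_s x' \<longrightarrow> v_hat x' = v_hat x) \<and>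
        (\<forall>m\<le>last_acc M. Acc x' m \<longleftrightarrow> Acc x m \<or> (InLoop x' \<and> v_cur x' \<in> accept M m))}"

definition l2s_label :: "('s, 'ap) fair_kripke \<Rightarrow> 's l2s_state \<Rightarrow> 'ap l2s_prop set" where
  "l2s_label M x =
     Orig ` label M (v_cur x) \<union> (if LoopClosed x then {LoopClosedProp} else {})"

definition l2s :: "('s, 'ap) fair_kripke \<Rightarrow> ('s l2s_state, 'ap l2s_prop) kripke" where
  "l2s M = \<lparr>states = l2s_states M, trans_rel = l2s_trans M,
             inits = l2s_inits M, label = l2s_label M\<rparr>"

end

theory Submission
  imports Defs
begin

text \<open>A fair path visits some state \<open>s\<close> infinitely often, so between two suitably chosen visits to
  \<open>s\<close> it meets every acceptance set; guessing the first of these visits as the loop start gives a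
  run of the transformed structure that closes its loop at the second. Conversely, in a run reaching
  \<open>LoopClosed\<close> the value saved in \<open>v_hat\<close> is that of a strictly earlier state, and the flags \<open>Acc\<close>
  witness visits to the acceptance sets since then; hence the run projects to a fair lasso.\<close>

text \<open>Folds the time line onto the positions below \<open>j\<close>: the stem up to
  \<open>i\<close>, then endless turns through the loop. Position \<open>j\<close> itself never
  occurs; \<open>i\<close> stands in for it.\<close>

definition lasso_index :: "nat \<Rightarrow> nat \<Rightarrow> nat \<Rightarrow> nat" where
  "lasso_index i j k = (if k < i then k else i + (k - i) mod (j - i))"

lemma lasso_index_less:
  assumes "i < j"
  shows "lasso_index i j k < j"
proof -
  have "(k - i) mod (j - i) < j - i"
    using assms by simp
  then show ?thesis
    using assms unfolding lasso_index_def by (cases "k < i"; simp only: if_True if_False; linarith)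
qed

lemma lasso_index_Suc:
  assumes "i < j"
  shows "lasso_index i j (Suc k) = Suc (lasso_index i j k)
    \<or> Suc (lasso_index i j k) = j \<and> lasso_index i j (Suc k) = i"
proof (cases "k < i")
  case True
  then show ?thesis
    unfolding lasso_index_def by (cases "Suc k = i") auto
next
  case False
  then show ?thesis
    using assms by (auto simp: lasso_index_def Suc_diff_le mod_Suc)
qed

text \<open>The case \<open>n = j\<close> has to be covered because acceptance visits are collected
  after \<open>i\<close> up to and including \<open>j\<close>.\<close>

lemma lasso_index_periodic:
  assumes "i \<le> n" "n \<le> j"
  shows "lasso_index i j (n + (j - i) * c) = (if n = j then i else n)"
proof -
  have "n + (j - i) * c - i = (n - i) + (j - i) * c"
    using assms by simp
  then have "(n + (j - i) * c - i) mod (j - i) = (n - i) mod (j - i)"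
    by simp
  moreover have "(n - i) mod (j - i) = (if n = j then 0 else n - i)"
    using assms by simp
  ultimately show ?thesis
    using assms by (simp add: lasso_index_def)
qed

text \<open>Every turn of the loop repeats the visit. If \<open>n = j\<close>, the lasso is at
  \<open>i\<close> instead, which is harmless since \<open>q i = q j\<close>.\<close>

lemma lasso_visits_infinitely_often:
  assumes "i < j" "q i = q j" "i < n" "n \<le> j" "q n \<in> A"
  shows "\<exists>\<^sub>\<infinity>k. q (lasso_index i j k) \<in> A"
  unfolding INFM_nat
proof
  fix m
  have "q (lasso_index i j (n + (j - i) * m)) \<in> A"
    using assms by (auto simp: lasso_index_periodic)
  moreover have "m < n + (j - i) * m"
  proof -
    have "1 * m \<le> (j - i) * m"
      using assms(1) by (intro mult_right_mono) auto
    then show ?thesis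
      using assms(3) by linarith
  qed
  ultimately show "\<exists>k>m. q (lasso_index i j k) \<in> A"
    by blast
qed

text \<open>The back edge from position \<open>j - 1\<close> to \<open>i\<close> is the edge from
  \<open>q (j - 1)\<close> to \<open>q j\<close>, as \<open>q i = q j\<close>.\<close>

lemma infinite_path_lasso:
  assumes "i < j" "q i = q j"
    and "\<And>k. k < j \<Longrightarrow> q k \<in> states M"
    and "\<And>k. k < j \<Longrightarrow> (q k, q (Suc k)) \<in> trans_rel M"
  shows "infinite_path M (\<lambda>k. q (lasso_index i j k))"
  unfolding infinite_path_def
proof (intro conjI allI)
  fix k
  show "q (lasso_index i j k) \<in> states M"
    using assms lasso_index_less by metis
  show "(q (lasso_index i j k), q (lasso_index i j (Suc k))) \<in> trans_rel M"
    using lasso_index_Suc[OF assms(1), of k] assms(2) assms(4)[OF lasso_index_less[OF assms(1), of k]]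
    by auto
qed

text \<open>By the pigeonhole principle some state recurs infinitely often. Only finitely many
  acceptance sets have to be met after one of its visits, so a later visit lies beyond all of
  them.\<close>

lemma fair_path_segment:
  assumes "finite (states M)" "infinite_path M p" "fair M p"
  obtains i j where "i < j" "p i = p j"
    "\<And>m. m \<le> last_acc M \<Longrightarrow> \<exists>n. i < n \<and> n \<le> j \<and> p n \<in> accept M m"
proof -
  have "finite (range p)"
    using assms(1,2) finite_subset[of "range p" "states M"] by (auto simp: infinite_path_def)
  then obtain i where i: "infinite {k \<in> UNIV. p k = p i}"
    using pigeonhole_infinite[of UNIV p] by auto
  have "\<exists>n>i. p n \<in> accept M m" if "m \<le> last_acc M" for m
    using assms(3) that by (auto simp: fair_def INFM_nat)
  then obtain g where g: "\<And>m. m \<le> last_acc M \<Longrightarrow> i < g m \<and> p (g m) \<in> accept M m"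
    by metis
  \<comment> \<open>Inserting \<open>i\<close> makes the same bound also yield
    \<open>i < j\<close>.\<close>
  obtain j where j: "p j = p i" "Max (insert i (g ` {..last_acc M})) < j"
    using i unfolding infinite_nat_iff_unbounded by blast
  then have "i < j" "\<And>m. m \<le> last_acc M \<Longrightarrow> g m < j"
    by auto
  then show thesis
    using that[of i j] g j(1) by (metis less_imp_le)
qed

text \<open>A transition with \<open>l_s\<close> set in its target saves the state it leaves, so
  saving \<open>p i\<close> means setting \<open>l_s\<close> at \<open>Suc i\<close>. Until then
  \<open>v_hat\<close> is a mere placeholder; \<open>p 0\<close> serves as some element of its
  range.\<close>

definition l2s_run :: "('s, 'ap) fair_kripke \<Rightarrow> (nat \<Rightarrow> 's) \<Rightarrow> nat \<Rightarrow> nat \<Rightarrow> nat \<Rightarrow> 's l2s_state" where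
  "l2s_run M p i j k = \<lparr>v_cur = p k, v_hat = (if k \<le> i then p 0 else p i), l_s = (k = Suc i),
     InLoop = (i < k), LoopClosed = (k = j),
     Acc = (\<lambda>m. m \<le> last_acc M \<and> (\<exists>n. i < n \<and> n \<le> k \<and> p n \<in> accept M m))\<rparr>"

lemma l2s_run_reachable:
  assumes "infinite_path M p" "initialised M p" "i < j" "p i = p j"
    and "\<And>m. m \<le> last_acc M \<Longrightarrow> \<exists>n. i < n \<and> n \<le> j \<and> p n \<in> accept M m"
  shows "reachable (l2s M) (l2s_run M p i j j)"
proof -
  let ?x = "l2s_run M p i j"
  let ?xs = "map ?x [0..<Suc j]"
  have states: "?x k \<in> l2s_states M" for k
    using assms
    by (auto simp: l2s_states_def l2s_valuations_def l2s_run_def infinite_path_def)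
  have "(?x k, ?x (Suc k)) \<in> l2s_trans M" for k
  proof -
    \<comment> \<open>Moving on extends the window of recorded visits by \<open>Suc k\<close>, which
      counts exactly if \<open>i < Suc k\<close>, that is, if the loop has been entered.\<close>
    have "Acc (?x (Suc k)) m \<longleftrightarrow> Acc (?x k) m \<or> (InLoop (?x (Suc k)) \<and> v_cur (?x (Suc k)) \<in> accept M m)"
      if "m \<le> last_acc M" for m
      using that by (auto simp: l2s_run_def le_Suc_eq)
    moreover have "(v_cur (?x k), v_cur (?x (Suc k))) \<in> trans_rel M"
      using assms(1) by (simp add: l2s_run_def infinite_path_def)
    moreover have "InLoop (?x (Suc k)) \<longleftrightarrow> InLoop (?x k) \<or> l_s (?x (Suc k))"
      "InLoop (?x k) \<longrightarrow> \<not> l_s (?x (Suc k))"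
      "l_s (?x (Suc k)) \<longrightarrow> v_hat (?x (Suc k)) = v_cur (?x k)"
      "\<not> l_s (?x (Suc k)) \<longrightarrow> v_hat (?x (Suc k)) = v_hat (?x k)"
      by (auto simp: l2s_run_def)
    ultimately show ?thesis
      using states by (simp add: l2s_trans_def)
  qed
  then have "finite_path (l2s M) ?xs"
    using states by (auto simp: finite_path_def l2s_def nth_append simp del: upt_Suc)
  moreover have "hd ?xs = ?x 0"
    by (simp add: hd_map del: upt_Suc)
  then have "hd ?xs \<in> inits (l2s M)"
    using states[of 0] assms(2)
    by (simp add: l2s_def l2s_inits_def initialised_def) (simp add: l2s_run_def)
  moreover have "last ?xs = ?x j"
    by simp
  ultimately show ?thesis
    unfolding reachable_def by blast
qed

text \<open>Outside the loop the invariant keeps all flags clear, so that flags found set later can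
  only stem from visits after the saved position.\<close>

lemma l2s_run_invariant:
  assumes "x 0 \<in> l2s_inits M" "\<And>k. k < n \<Longrightarrow> (x k, x (Suc k)) \<in> l2s_trans M" "k \<le> n"
  shows "if InLoop (x k)
    then \<exists>i<k. v_hat (x k) = v_cur (x i) \<and>
      (\<forall>m\<le>last_acc M. Acc (x k) m \<longrightarrow> (\<exists>l. i < l \<and> l \<le> k \<and> v_cur (x l) \<in> accept M m))
    else \<forall>m\<le>last_acc M. \<not> Acc (x k) m"
  using assms(3)
proof (induction k)
  case 0
  then show ?case
    using assms(1) by (auto simp: l2s_inits_def)
next
  case (Suc k)
  have tr: "(x k, x (Suc k)) \<in> l2s_trans M"
    using assms(2) Suc.prems by simp
  show ?case
  proof (cases "InLoop (x k)")
    case True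
    then obtain i where i: "i < k" "v_hat (x k) = v_cur (x i)"
      "\<And>m. m \<le> last_acc M \<Longrightarrow> Acc (x k) m \<Longrightarrow> \<exists>l. i < l \<and> l \<le> k \<and> v_cur (x l) \<in> accept M m"
      using Suc by auto
    have "\<exists>l. i < l \<and> l \<le> Suc k \<and> v_cur (x l) \<in> accept M m"
      if "m \<le> last_acc M" "Acc (x (Suc k)) m" for m
    proof (cases "Acc (x k) m")
      case True
      then show ?thesis
        using i(3)[OF that(1)] le_SucI by blast
    next
      case False
      then have "v_cur (x (Suc k)) \<in> accept M m"
        using tr that by (auto simp: l2s_trans_def)
      then show ?thesis
        using i(1) by (intro exI[of _ "Suc k"]) simp
    qed
    moreover have "InLoop (x (Suc k))" "v_hat (x (Suc k)) = v_cur (x i)"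
      using tr True i(2) by (auto simp: l2s_trans_def)
    ultimately show ?thesis
      using less_SucI[OF i(1)] by (simp only: if_True) blast
  next
    case False
    then have no_acc: "\<And>m. m \<le> last_acc M \<Longrightarrow> \<not> Acc (x k) m"
      using Suc by auto
    show ?thesis
    proof (cases "InLoop (x (Suc k))")
      case True
      \<comment> \<open>The loop is entered here, so \<open>k\<close> is the saved position, and any
        flag now set comes from position \<open>Suc k\<close> alone.\<close>
      then have "v_hat (x (Suc k)) = v_cur (x k)"
        "\<And>m. m \<le> last_acc M \<Longrightarrow> Acc (x (Suc k)) m \<Longrightarrow> v_cur (x (Suc k)) \<in> accept M m"
        using tr False no_acc by (auto simp: l2s_trans_def)
      then show ?thesis
        using True by auto
    next
      case False
      then show ?thesis
        using tr no_acc by (auto simp: l2s_trans_def)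
    qed
  qed
qed

lemma fair_path_if_LoopClosed_reachable:
  fixes M :: "('s, 'ap) fair_kripke"
  assumes "LoopClosed y" "reachable (l2s M) y"
  shows "\<exists>p. infinite_path M p \<and> initialised M p \<and> fair M p"
proof -
  obtain xs where xs: "finite_path (l2s M) xs" "hd xs \<in> l2s_inits M" "last xs = y"
    using assms(2) by (auto simp: reachable_def l2s_def)
  define j where "j = length xs - 1"
  define x where "x = (!) xs"
  define q where "q k = v_cur (x k)" for k
  have ne: "xs \<noteq> []"
    using xs(1) by (simp add: finite_path_def)
  have x0: "x 0 \<in> l2s_inits M"
    using xs(2) ne by (simp add: x_def hd_conv_nth)
  have xj: "x j = y"
    using xs(3) ne by (simp add: x_def j_def last_conv_nth)
  have st: "x k \<in> l2s_states M" if "k \<le> j" for k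
  proof -
    have "k < length xs"
      using that ne unfolding j_def by (cases xs) auto
    then have "xs ! k \<in> set xs"
      by simp
    then show ?thesis
      using xs(1) by (auto simp: finite_path_def l2s_def x_def)
  qed
  have tr: "(x k, x (Suc k)) \<in> l2s_trans M" if "k < j" for k
    using xs(1) that by (auto simp: finite_path_def l2s_def x_def j_def)
  have closed: "InLoop (x j)" "v_cur (x j) = v_hat (x j)" "\<And>m. m \<le> last_acc M \<Longrightarrow> Acc (x j) m"
    using st[of j] xj assms(1) by (auto simp: l2s_states_def)
  \<comment> \<open>At the last state \<open>LoopClosed\<close> turns the saved value
    \<open>v_hat\<close> into the current one and raises all flags, so the invariant yields a closed
    loop that meets every acceptance set.\<close>
  obtain i where i: "i < j" "q i = q j"
    "\<And>m. m \<le> last_acc M \<Longrightarrow> \<exists>l. i < l \<and> l \<le> j \<and> q l \<in> accept M m"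
    using l2s_run_invariant[OF x0 tr, of j j] closed by (auto simp: q_def)
  let ?p = "\<lambda>k. q (lasso_index i j k)"
  have "infinite_path M ?p"
  proof (rule infinite_path_lasso[OF i(1,2)])
    fix k
    assume "k < j"
    then show "q k \<in> states M" "(q k, q (Suc k)) \<in> trans_rel M"
      using st[of k] tr[of k] by (auto simp: q_def l2s_states_def l2s_trans_def)
  qed
  moreover have "lasso_index i j 0 = 0"
    by (simp add: lasso_index_def)
  then have "initialised M ?p"
    using x0 by (simp add: initialised_def q_def l2s_inits_def)
  moreover have "fair M ?p"
    unfolding fair_def using i lasso_visits_infinitely_often[OF i(1,2)] by blast
  ultimately show ?thesis
    by blast
qed

theorem theorem4p1:
  fixes M :: "('s, 'ap) fair_kripke"
  assumes "is_fair_kripke M"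
  shows "(\<exists>p. infinite_path M p \<and> initialised M p \<and> fair M p) \<longleftrightarrow>
         (\<exists>x\<in>states (l2s M). LoopClosed x \<and> reachable (l2s M) x)"
proof
  assume "\<exists>p. infinite_path M p \<and> initialised M p \<and> fair M p"
  then obtain p where p: "infinite_path M p" "initialised M p" "fair M p"
    by blast
  have "finite (states M)"
    using assms by (simp add: is_fair_kripke_def)
  then obtain i j where ij: "i < j" "p i = p j"
    "\<And>m. m \<le> last_acc M \<Longrightarrow> \<exists>n. i < n \<and> n \<le> j \<and> p n \<in> accept M m"
    using fair_path_segment p(1,3) by blast
  let ?y = "l2s_run M p i j j"
  have y: "reachable (l2s M) ?y"
    using l2s_run_reachable p(1,2) ij by blast
  then have "?y \<in> states (l2s M)"
    unfolding reachable_def finite_path_def by (metis last_in_set subsetD)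
  moreover have "LoopClosed ?y"
    by (simp add: l2s_run_def)
  ultimately show "\<exists>x\<in>states (l2s M). LoopClosed x \<and> reachable (l2s M) x"
    using y by blast
next
  assume "\<exists>x\<in>states (l2s M). LoopClosed x \<and> reachable (l2s M) x"
  then show "\<exists>p. infinite_path M p \<and> initialised M p \<and> fair M p"
    using fair_path_if_LoopClosed_reachable by blast
qed

end
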